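(* Let $L$ be either $\mathbf{IL}^-(\mathbf{J2},\mathbf{J5})$ or $\mathbf{IL}^-(\mathbf{J2},\mathbf{J4}_+,\mathbf{J5})$. Then for every formula $A$ the following are equivalent: (1) $L\vdash A$; (2) $A$ is valid in every $\mathbf{ILS}$-frame in which all axioms of $L$ are valid; (3) $A$ is valid in every finite $\mathbf{ILS}$-frame in which all axioms of $L$ are valid.
   Context: Formulas are built from countably many propositional variables, $\top,\bot$, $\neg,\land,\lor,\to$, unary $\Box$ and binary $\rhd$; $\Diamond A$ abbreviates $\neg\Box\neg A$. The logic $\mathbf{IL}^-$ has as axioms all tautologies, $\Box(A\to B)\to(\Box A\to\Box B)$, $\Box(\Box A\to A)\to\Box A$, $(A\rhd C)\land(B\rhd C)\to(A\lor B)\rhd C$, and $\Box A\leftrightarrow(\neg A)\rhd\bot$; rules: modus ponens, necessitation, from $A\to B$ infer $C\rhd A\to C\rhd B$, from $A\to B$ infer $B\rhd C\to A\rhd C$. $\mathbf{IL}^-(\Sigma_1,\dots,\Sigma_n)$ is $\mathbf{IL}^-$ with schemata $\Sigma_i$ added as axioms. Schemata: $\mathbf{J2}$: $(A\rhd B)\land(B\rhd C)\to A\rhd C$; $\mathbf{J4}_+$: $\Box(A\to B)\to(C\rhd A\to C\rhd B)$; $\mathbf{J5}$: $\Diamond A\rhd A$. An $\mathbf{ILS}$-frame is a triple $\langle W,R,\{S_x\}_{x\in W}\rangle$ with $W$ nonempty, $R$ transitive and conversely well-founded on $W$, each $S_x\subseteq W\times(\mathcal P(W)\setminus\{\emptyset\})$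 such that $yS_xV$ implies $xRy$, and (monotonicity) $yS_xV$ and $V\subseteq U$ imply $yS_xU$. Satisfaction: usual Boolean clauses, $x\Vdash\Box A$ iff $y\Vdash A$ for all $y$ with $xRy$, and $x\Vdash A\rhd B$ iff for every $y$ with $xRy$ and $y\Vdash A$ there is $V\subseteq W$ with $yS_xV$ and $z\Vdash B$ for all $z\in V$. Validity in a frame: truth at every point under every satisfaction relation (for schemata: all instances). *)

theory Defs
  imports Main
begin

section \<open>Formulas\<close>

datatype fm =
    Var nat
  | Top ("\<^bold>\<top>")
  | Bot ("\<^bold>\<bottom>")
  | Neg fm ("\<^bold>\<not> _" [80] 80)
  | And fm fm (infixr "\<^bold>\<and>" 65)
  | Or fm fm (infixr "\<^bold>\<or>" 60)
  | Imp fm fm (infixr "\<^bold>\<longrightarrow>" 55)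
  | Box fm ("\<^bold>\<box> _" [80] 80)
  | Rhd fm fm (infix "\<^bold>\<rhd>" 70)

abbreviation Dia :: "fm \<Rightarrow> fm" ("\<^bold>\<diamond> _" [80] 80) where
  "\<^bold>\<diamond> A \<equiv> \<^bold>\<not> \<^bold>\<box> \<^bold>\<not> A"

abbreviation Iff :: "fm \<Rightarrow> fm \<Rightarrow> fm" (infix "\<^bold>\<longleftrightarrow>" 50) where
  "A \<^bold>\<longleftrightarrow> B \<equiv> (A \<^bold>\<longrightarrow> B) \<^bold>\<and> (B \<^bold>\<longrightarrow> A)"

section \<open>The logics\<close>

text \<open>Propositional evaluation: formulas whose main symbol is modal are treated as atoms,
  so the tautologies are exactly the substitution instances of classical tautologies.\<close>

primrec peval :: "(fm \<Rightarrow> bool) \<Rightarrow> fm \<Rightarrow> bool" where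
  "peval v (Var n) = v (Var n)"
| "peval v \<^bold>\<top> = True"
| "peval v \<^bold>\<bottom> = False"
| "peval v (\<^bold>\<not> A) = (\<not> peval v A)"
| "peval v (A \<^bold>\<and> B) = (peval v A \<and> peval v B)"
| "peval v (A \<^bold>\<or> B) = (peval v A \<or> peval v B)"
| "peval v (A \<^bold>\<longrightarrow> B) = (peval v A \<longrightarrow> peval v B)"
| "peval v (\<^bold>\<box> A) = v (\<^bold>\<box> A)"
| "peval v (A \<^bold>\<rhd> B) = v (A \<^bold>\<rhd> B)"

definition tautology :: "fm \<Rightarrow> bool" where
  "tautology A \<longleftrightarrow> (\<forall>v. peval v A)"

inductive_set ILminus_axioms :: "fm set" where
  Taut: "tautology A \<Longrightarrow> A \<in> ILminus_axioms"
| K: "\<^bold>\<box> (A \<^bold>\<longrightarrow> B) \<^bold>\<longrightarrow> (\<^bold>\<box> A \<^bold>\<longrightarrow> \<^bold>\<box> B) \<in> ILminus_axioms"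
| Loeb: "\<^bold>\<box> (\<^bold>\<box> A \<^bold>\<longrightarrow> A) \<^bold>\<longrightarrow> \<^bold>\<box> A \<in> ILminus_axioms"
| J3: "((A \<^bold>\<rhd> C) \<^bold>\<and> (B \<^bold>\<rhd> C)) \<^bold>\<longrightarrow> ((A \<^bold>\<or> B) \<^bold>\<rhd> C) \<in> ILminus_axioms"
| J6: "(\<^bold>\<box> A \<^bold>\<longleftrightarrow> (\<^bold>\<not> A) \<^bold>\<rhd> \<^bold>\<bottom>) \<in> ILminus_axioms"

text \<open>A schema is the set of its instances, and a logic is given by the set of its axioms.\<close>

definition J2 :: "fm set" where
  "J2 = {((A \<^bold>\<rhd> B) \<^bold>\<and> (B \<^bold>\<rhd> C)) \<^bold>\<longrightarrow> (A \<^bold>\<rhd> C) | A B C. True}"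

definition J4plus :: "fm set" where
  "J4plus = {\<^bold>\<box> (A \<^bold>\<longrightarrow> B) \<^bold>\<longrightarrow> ((C \<^bold>\<rhd> A) \<^bold>\<longrightarrow> (C \<^bold>\<rhd> B)) | A B C. True}"

definition J5 :: "fm set" where
  "J5 = {(\<^bold>\<diamond> A) \<^bold>\<rhd> A | A. True}"

definition ILminus :: "fm set list \<Rightarrow> fm set" where
  "ILminus \<Sigma>s = ILminus_axioms \<union> \<Union> (set \<Sigma>s)"

inductive provable :: "fm set \<Rightarrow> fm \<Rightarrow> bool" (infix "\<turnstile>" 45) for L :: "fm set" where
  Axiom: "A \<in> L \<Longrightarrow> L \<turnstile> A"
| MP: "L \<turnstile> A \<^bold>\<longrightarrow> B \<Longrightarrow> L \<turnstile> A \<Longrightarrow> L \<turnstile> B"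
| Nec: "L \<turnstile> A \<Longrightarrow> L \<turnstile> \<^bold>\<box> A"
| R1: "L \<turnstile> A \<^bold>\<longrightarrow> B \<Longrightarrow> L \<turnstile> (C \<^bold>\<rhd> A) \<^bold>\<longrightarrow> (C \<^bold>\<rhd> B)"
| R2: "L \<turnstile> A \<^bold>\<longrightarrow> B \<Longrightarrow> L \<turnstile> (B \<^bold>\<rhd> C) \<^bold>\<longrightarrow> (A \<^bold>\<rhd> C)"

section \<open>Frames and satisfaction\<close>

text \<open>\<open>(y, V) \<in> Srel F x\<close> stands for \<open>y S\<^sub>x V\<close>; only the values at \<open>x \<in> Worlds F\<close> matter.\<close>

record 'w frame =
  Worlds :: "'w set"
  Rel :: "('w \<times> 'w) set"
  Srel :: "'w \<Rightarrow> ('w \<times> 'w set) set"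

definition ILS_frame :: "'w frame \<Rightarrow> bool" where
  "ILS_frame F \<longleftrightarrow>
     Worlds F \<noteq> {} \<and>
     Rel F \<subseteq> Worlds F \<times> Worlds F \<and>
     trans (Rel F) \<and>
     wf ((Rel F)\<inverse>) \<and>
     (\<forall>x \<in> Worlds F. Srel F x \<subseteq> Worlds F \<times> (Pow (Worlds F) - {{}})) \<and>
     (\<forall>x \<in> Worlds F. \<forall>y V. (y, V) \<in> Srel F x \<longrightarrow> (x, y) \<in> Rel F) \<and>
     (\<forall>x \<in> Worlds F. \<forall>y V U. (y, V) \<in> Srel F x \<and> V \<subseteq> U \<and> U \<subseteq> Worlds F \<longrightarrow> (y, U) \<in> Srel F x)"

text \<open>A satisfaction relation is determined by its values \<open>\<nu>\<close> on the propositional variables.\<close>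

primrec sat :: "'w frame \<Rightarrow> ('w \<Rightarrow> nat \<Rightarrow> bool) \<Rightarrow> 'w \<Rightarrow> fm \<Rightarrow> bool" where
  "sat F \<nu> x (Var n) = \<nu> x n"
| "sat F \<nu> x \<^bold>\<top> = True"
| "sat F \<nu> x \<^bold>\<bottom> = False"
| "sat F \<nu> x (\<^bold>\<not> A) = (\<not> sat F \<nu> x A)"
| "sat F \<nu> x (A \<^bold>\<and> B) = (sat F \<nu> x A \<and> sat F \<nu> x B)"
| "sat F \<nu> x (A \<^bold>\<or> B) = (sat F \<nu> x A \<or> sat F \<nu> x B)"
| "sat F \<nu> x (A \<^bold>\<longrightarrow> B) = (sat F \<nu> x A \<longrightarrow> sat F \<nu> x B)"
| "sat F \<nu> x (\<^bold>\<box> A) = (\<forall>y. (x, y) \<in> Rel F \<longrightarrow> sat F \<nu> y A)"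
| "sat F \<nu> x (A \<^bold>\<rhd> B) =
     (\<forall>y. (x, y) \<in> Rel F \<and> sat F \<nu> y A \<longrightarrow>
       (\<exists>V. V \<subseteq> Worlds F \<and> (y, V) \<in> Srel F x \<and> (\<forall>z \<in> V. sat F \<nu> z B)))"

definition valid :: "'w frame \<Rightarrow> fm \<Rightarrow> bool" where
  "valid F A \<longleftrightarrow> (\<forall>\<nu>. \<forall>x \<in> Worlds F. sat F \<nu> x A)"

definition ILS_frame_of :: "fm set \<Rightarrow> 'w frame \<Rightarrow> bool" where
  "ILS_frame_of L F \<longleftrightarrow> ILS_frame F \<and> (\<forall>B \<in> L. valid F B)"

text \<open>HOL cannot quantify over types inside a formula, so ``every frame'' means every frame whose
  set of worlds is a subset of a type \<open>'w\<close>. Completeness is to be stated for an arbitrary infinite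
  \<open>'w\<close>: then every finite frame has an isomorphic copy over \<open>'w\<close>, and every frame whatsoever
  lives on some infinite type.\<close>

end

theory Submission
  imports Defs
begin

text \<open>Completeness goes through a finite canonical frame. A world is the trace of a maximal consistent
  set on a finite set of formulas together with a list of labels, and a successor of \<open>x\<close> whose
  first new label is \<open>C\<close> may be \<open>C\<close>-critical: it refutes \<open>E\<close> and \<open>\<^bold>\<diamond> E\<close> whenever \<open>E \<^bold>\<rhd> C\<close> holds at \<open>x\<close>.
  Since \<open>C \<^bold>\<rhd> C\<close> need not hold, a critical world may satisfy \<open>C\<close>. A set \<open>V\<close> reachable by \<open>S\<^sub>x\<close> from a
  \<open>C\<close>-critical world therefore has to contain two witnesses: a \<open>C\<close>-critical world, which makes \<open>S\<^sub>x\<close>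
  compose as \<open>J2\<close> demands, and a possibly different world without \<open>C\<close>, which keeps \<open>V\<close> from
  forcing \<open>C\<close>. Only under \<open>J4\<^sub>+\<close> must the second witness be a successor of \<open>x\<close>.\<close>

section \<open>Validity in ILS-frames\<close>

text \<open>Satisfaction at a fixed world is itself a propositional evaluation with modal formulas
  as atoms; hence tautologies hold everywhere.\<close>

lemma peval_sat: "peval (sat F \<nu> x) A = sat F \<nu> x A"
  by (induction A) auto

lemma valid_ILminus_axioms:
  assumes F: "ILS_frame F" and "A \<in> ILminus_axioms"
  shows "valid F A"
  using assms(2)
proof cases
  case Taut
  then show ?thesis
    unfolding valid_def tautology_def by (simp add: peval_sat[symmetric])
next
  case (K A B)
  then show ?thesis by (simp add: valid_def)
next
  case (Loeb B)
  have wf: "wf ((Rel F)\<inverse>)" and tr: "trans (Rel F)"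
    using F by (auto simp: ILS_frame_def)
  \<comment> \<open>Induction from above along the conversely well-founded relation: successors of
    \<open>y\<close> are successors of \<open>x\<close> by transitivity, so \<open>B\<close> holds
    at them, thus \<box> B holds at \<open>y\<close>, and then \<open>B\<close>.\<close>
  have "(x, y) \<in> Rel F \<longrightarrow> sat F \<nu> y B" if "sat F \<nu> x (\<^bold>\<box> (\<^bold>\<box> B \<^bold>\<longrightarrow> B))" for \<nu> x y
    using wf
  proof (induction y rule: wf_induct_rule)
    case (less y)
    show ?case
    proof
      assume xy: "(x, y) \<in> Rel F"
      have "sat F \<nu> z B" if "(y, z) \<in> Rel F" for z
        using less that xy tr by (meson converseI transD)
      with that xy show "sat F \<nu> y B" by simp
    qed
  qed
  with Loeb show ?thesis by (simp add: valid_def)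
next
  case (J3 A C B)
  have "sat F \<nu> x ((A \<^bold>\<or> B) \<^bold>\<rhd> C)" if "sat F \<nu> x (A \<^bold>\<rhd> C)" "sat F \<nu> x (B \<^bold>\<rhd> C)" for \<nu> x
    using that by (simp only: sat.simps) blast
  with J3 show ?thesis by (simp only: valid_def sat.simps(5,7)) blast
next
  case (J6 B)
  \<comment> \<open>A nonempty set never forces \<bottom>, so (\<not> B) \<rhd> \<bottom> just
    excludes successors refuting \<open>B\<close>.\<close>
  have S: "V \<noteq> {}" if "x \<in> Worlds F" "(y, V) \<in> Srel F x" for x y V
    using F that unfolding ILS_frame_def by blast
  have "sat F \<nu> x ((\<^bold>\<not> B) \<^bold>\<rhd> \<^bold>\<bottom>) \<longleftrightarrow> sat F \<nu> x (\<^bold>\<box> B)" if "x \<in> Worlds F" for \<nu> x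
    using S[OF that] by auto
  then show ?thesis
    unfolding J6 valid_def sat.simps(5,7) by blast
qed

lemma soundness:
  assumes F: "ILS_frame_of L F" and "L \<turnstile> A"
  shows "valid F A"
  using assms(2)
proof induction
  case (Axiom A)
  then show ?case using F by (simp add: ILS_frame_of_def)
next
  case (Nec A)
  have "Rel F \<subseteq> Worlds F \<times> Worlds F" using F by (simp add: ILS_frame_of_def ILS_frame_def)
  then show ?case using Nec.IH unfolding valid_def by auto
next
  case (R1 A B C)
  then have AB: "V \<subseteq> Worlds F \<Longrightarrow> \<forall>z\<in>V. sat F \<nu> z A \<Longrightarrow> \<forall>z\<in>V. sat F \<nu> z B" for \<nu> V
    by (auto simp: valid_def)
  have "sat F \<nu> x (C \<^bold>\<rhd> B)" if "sat F \<nu> x (C \<^bold>\<rhd> A)" for \<nu> x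
    using that AB unfolding sat.simps by meson
  then show ?case unfolding valid_def sat.simps(7) by blast
next
  case (R2 A B C)
  have "Rel F \<subseteq> Worlds F \<times> Worlds F" using F by (simp add: ILS_frame_of_def ILS_frame_def)
  then have AB: "(x, y) \<in> Rel F \<Longrightarrow> sat F \<nu> y A \<Longrightarrow> sat F \<nu> y B" for \<nu> x y
    using R2.IH by (auto simp: valid_def)
  have "sat F \<nu> x (A \<^bold>\<rhd> C)" if "sat F \<nu> x (B \<^bold>\<rhd> C)" for \<nu> x
    using that AB unfolding sat.simps by meson
  then show ?case unfolding valid_def sat.simps(7) by blast
qed (auto simp: valid_def)

section \<open>Transfer along a bijection of the worlds\<close>

text \<open>The canonical worlds are pairs of a formula set and a list, whereas the theorem concerns
  an arbitrary infinite type. With \<open>g\<close> leading from the new worlds to the old ones, all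
  relations are plain preimages.\<close>

definition pullback :: "'v set \<Rightarrow> ('v \<Rightarrow> 'w) \<Rightarrow> 'w frame \<Rightarrow> 'v frame" where
  "pullback W g F = \<lparr>Worlds = W, Rel = {(a, b). a \<in> W \<and> b \<in> W \<and> (g a, g b) \<in> Rel F},
     Srel = (\<lambda>a. {(b, V). b \<in> W \<and> V \<subseteq> W \<and> (g b, g ` V) \<in> Srel F (g a)})\<rparr>"

lemma pullback_sel [simp]:
  "Worlds (pullback W g F) = W"
  "(a, b) \<in> Rel (pullback W g F) \<longleftrightarrow> a \<in> W \<and> b \<in> W \<and> (g a, g b) \<in> Rel F"
  "(b, V) \<in> Srel (pullback W g F) a \<longleftrightarrow> b \<in> W \<and> V \<subseteq> W \<and> (g b, g ` V) \<in> Srel F (g a)"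
  by (simp_all add: pullback_def)

lemma ILS_frame_pullback:
  assumes F: "ILS_frame F" and g: "bij_betw g W (Worlds F)"
  shows "ILS_frame (pullback W g F)"
proof -
  have img: "g ` W = Worlds F" using g by (simp add: bij_betw_def)
  have 1: "W \<noteq> {}" using F img by (auto simp: ILS_frame_def)
  have 2: "trans (Rel (pullback W g F))"
    using F unfolding ILS_frame_def by (auto intro!: transI dest: transD)
  have "(Rel (pullback W g F))\<inverse> \<subseteq> inv_image ((Rel F)\<inverse>) g"
    by auto
  then have 3: "wf ((Rel (pullback W g F))\<inverse>)"
    using F by (meson ILS_frame_def wf_inv_image wf_subset)
  have 4: "V \<noteq> {} \<and> (x, y) \<in> Rel (pullback W g F)"
    if "x \<in> W" "(y, V) \<in> Srel (pullback W g F) x" for x y V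
  proof -
    have "g x \<in> Worlds F" "(g y, g ` V) \<in> Srel F (g x)" "y \<in> W"
      using that img by auto
    moreover from this have "g ` V \<noteq> {}" "(g x, g y) \<in> Rel F"
      using F unfolding ILS_frame_def by blast+
    ultimately show ?thesis using that by auto
  qed
  have 5: "(y, U) \<in> Srel (pullback W g F) x"
    if "x \<in> W" "(y, V) \<in> Srel (pullback W g F) x" "V \<subseteq> U" "U \<subseteq> W" for x y V U
  proof -
    have "g x \<in> Worlds F" "(g y, g ` V) \<in> Srel F (g x)" "y \<in> W" "g ` V \<subseteq> g ` U"
      "g ` U \<subseteq> Worlds F"
      using that img by auto
    moreover from this have "(g y, g ` U) \<in> Srel F (g x)"
      using F unfolding ILS_frame_def by blast
    ultimately show ?thesis using that by auto
  qed
  show ?thesis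
    unfolding ILS_frame_def
  proof (intro conjI ballI allI impI)
    show "Worlds (pullback W g F) \<noteq> {}" "Rel (pullback W g F) \<subseteq> Worlds (pullback W g F) \<times> Worlds (pullback W g F)"
      using 1 by auto
    show "trans (Rel (pullback W g F))" "wf ((Rel (pullback W g F))\<inverse>)" by fact+
  next
    fix x assume "x \<in> Worlds (pullback W g F)"
    then have x: "x \<in> W" by simp
    have "(g y, {}) \<notin> Srel F (g x)" if "y \<in> W" for y
      using 4[OF x, of y "{}"] that by auto
    then show "Srel (pullback W g F) x \<subseteq> Worlds (pullback W g F) \<times> (Pow (Worlds (pullback W g F)) - {{}})"
      by auto
    show "(x, y) \<in> Rel (pullback W g F)" if "(y, V) \<in> Srel (pullback W g F) x" for y V
      using 4[OF x that] by simp
    show "(y, U) \<in> Srel (pullback W g F) x"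
      if "(y, V) \<in> Srel (pullback W g F) x \<and> V \<subseteq> U \<and> U \<subseteq> Worlds (pullback W g F)" for y V U
      using 5[OF x, of y V U] that by simp
  qed
qed

lemma sat_pullback:
  assumes F: "ILS_frame F" and g: "bij_betw g W (Worlds F)"
    and "\<And>a. a \<in> W \<Longrightarrow> \<nu> a = \<mu> (g a)" and "a \<in> W"
  shows "sat (pullback W g F) \<nu> a A = sat F \<mu> (g a) A"
  using assms(4)
proof (induction A arbitrary: a)
  have img: "g ` W = Worlds F" using g by (simp add: bij_betw_def)
  have "Rel F \<subseteq> Worlds F \<times> Worlds F" using F by (simp add: ILS_frame_def)
  then have "(c, y) \<in> Rel F \<Longrightarrow> \<exists>b\<in>W. y = g b" for c y using img by auto
  \<comment> \<open>All successors are values of \<open>g\<close>, so quantifying over them reduces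
    to quantifying over \<open>W\<close>.\<close>
  then have all_succ: "(\<forall>y. (c, y) \<in> Rel F \<longrightarrow> P y) \<longleftrightarrow> (\<forall>b\<in>W. (c, g b) \<in> Rel F \<longrightarrow> P (g b))"
    for c P by metis
  {
    case (Box A)
    then show ?case using all_succ by auto
  next
    case (Rhd A B)
    have *: "(\<exists>V. V \<subseteq> Worlds F \<and> (g b, V) \<in> Srel F (g a) \<and> (\<forall>z\<in>V. sat F \<mu> z B)) \<longleftrightarrow>
        (\<exists>V. V \<subseteq> W \<and> (b, V) \<in> Srel (pullback W g F) a \<and>
          (\<forall>z\<in>V. sat (pullback W g F) \<nu> z B))" (is "?l \<longleftrightarrow> ?r")
      if "b \<in> W" for b
    proof
      assume ?l
      then obtain V where V: "V \<subseteq> Worlds F" "(g b, V) \<in> Srel F (g a)" "\<forall>z\<in>V. sat F \<mu> z B"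
        by blast
      then obtain V' where "V' \<subseteq> W" "V = g ` V'"
        using img by (metis subset_imageE)
      with V that Rhd show ?r
        by (intro exI[of _ V']) auto
    next
      assume ?r
      then obtain V where V: "V \<subseteq> W" "(b, V) \<in> Srel (pullback W g F) a"
          "\<forall>z\<in>V. sat (pullback W g F) \<nu> z B"
        by blast
      then have "\<forall>z\<in>V. sat F \<mu> (g z) B" using Rhd.IH(2) by blast
      then show ?l
        using V img[symmetric] by (intro exI[of _ "g ` V"]) auto
    qed
    have "sat F \<mu> (g a) (A \<^bold>\<rhd> B) \<longleftrightarrow> (\<forall>b\<in>W. (g a, g b) \<in> Rel F \<and> sat F \<mu> (g b) A \<longrightarrow>
        (\<exists>V. V \<subseteq> Worlds F \<and> (g b, V) \<in> Srel F (g a) \<and> (\<forall>z\<in>V. sat F \<mu> z B)))"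
      using all_succ[of "g a"] by (simp add: imp_conjL)
    also have "\<dots> \<longleftrightarrow> (\<forall>b\<in>W. (g a, g b) \<in> Rel F \<and> sat (pullback W g F) \<nu> b A \<longrightarrow>
        (\<exists>V. V \<subseteq> W \<and> (b, V) \<in> Srel (pullback W g F) a \<and>
          (\<forall>z\<in>V. sat (pullback W g F) \<nu> z B)))"
      using * Rhd.IH by auto
    also have "\<dots> \<longleftrightarrow> sat (pullback W g F) \<nu> a (A \<^bold>\<rhd> B)"
      using Rhd.prems by auto
    finally show ?case by simp
  }
qed (use assms(3) in auto)

lemma valid_pullback:
  assumes F: "ILS_frame F" and g: "bij_betw g W (Worlds F)"
  shows "valid (pullback W g F) A \<longleftrightarrow> valid F A"
proof -
  have img: "g ` W = Worlds F" and inj: "inj_on g W" using g by (auto simp: bij_betw_def)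
  show ?thesis
  proof
    assume *: "valid (pullback W g F) A"
    show "valid F A"
      unfolding valid_def
    proof (intro allI ballI)
      fix \<mu> x assume "x \<in> Worlds F"
      then obtain a where "a \<in> W" "x = g a" using img by blast
      then show "sat F \<mu> x A"
        using * sat_pullback[OF F g, of "\<mu> \<circ> g" \<mu> a A] by (simp add: valid_def)
    qed
  next
    assume *: "valid F A"
    show "valid (pullback W g F) A"
      unfolding valid_def pullback_sel
    proof (intro allI ballI)
      fix \<nu> a assume "a \<in> W"
      then show "sat (pullback W g F) \<nu> a A"
        \<comment> \<open>The valuation on \<open>W\<close> is carried over by
          \<open>inv_into W g\<close>, a left inverse of \<open>g\<close> on \<open>W\<close> by
          injectivity.\<close>
        using * sat_pullback[OF F g, of \<nu> "\<nu> \<circ> inv_into W g" a A] img inj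
        by (auto simp: valid_def)
    qed
  qed
qed

section \<open>Maximal consistent sets\<close>

text \<open>Closure under modus ponens but not under necessitation: a theory describes a single
  world, where \<open>A\<close> may hold without \<box> A.\<close>

definition closed_theory :: "fm set \<Rightarrow> fm set \<Rightarrow> bool" where
  "closed_theory L T \<longleftrightarrow> (\<forall>A. L \<turnstile> A \<longrightarrow> A \<in> T) \<and> (\<forall>A B. A \<^bold>\<longrightarrow> B \<in> T \<longrightarrow> A \<in> T \<longrightarrow> B \<in> T)"

definition mcs :: "fm set \<Rightarrow> fm set \<Rightarrow> bool" where
  "mcs L M \<longleftrightarrow> closed_theory L M \<and> \<^bold>\<bottom> \<notin> M \<and> (\<forall>A. A \<in> M \<or> \<^bold>\<not> A \<in> M)"

locale extension =
  fixes L :: "fm set"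
  assumes IL: "ILminus_axioms \<subseteq> L"
begin

lemma taut: "(\<And>v. peval v A) \<Longrightarrow> L \<turnstile> A"
  using IL by (auto intro!: provable.Axiom ILminus_axioms.Taut simp: tautology_def)

text \<open>Avoiding \<open>G\<close> takes the place of consistency. Zorn gives a maximal theory
  \<open>M\<close> without \<open>G\<close>; by maximality it contains B \<longrightarrow> G for
  every \<open>B\<close> outside it. With both \<open>B\<close> and \<not> B outside, a case
  distinction would put \<open>G\<close> into \<open>M\<close>.\<close>

lemma lindenbaum:
  assumes T: "closed_theory L T" and G: "G \<notin> T"
  obtains M where "mcs L M" "T \<subseteq> M" "G \<notin> M"
proof -
  define X where "X = {T'. closed_theory L T' \<and> T \<subseteq> T' \<and> G \<notin> T'}"
  have "T \<in> X" using assms by (simp add: X_def)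
  have "\<Union> C \<in> X" if C: "C \<noteq> {}" "subset.chain X C" for C
  proof -
    have CX: "C \<subseteq> X" and ch: "\<And>P Q. P \<in> C \<Longrightarrow> Q \<in> C \<Longrightarrow> P \<subseteq> Q \<or> Q \<subseteq> P"
      using C(2) by (auto simp: subset_chain_def)
    have "closed_theory L (\<Union> C)"
      unfolding closed_theory_def
    proof (intro conjI allI impI)
      fix A assume "L \<turnstile> A"
      then show "A \<in> \<Union> C" using C(1) CX by (fastforce simp: X_def closed_theory_def)
    next
      fix A B assume "A \<^bold>\<longrightarrow> B \<in> \<Union> C" "A \<in> \<Union> C"
      then obtain P where "P \<in> C" "A \<^bold>\<longrightarrow> B \<in> P" "A \<in> P"
        using ch by blast
      then show "B \<in> \<Union> C" using CX by (fastforce simp: X_def closed_theory_def)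
    qed
    then show ?thesis using C(1) CX by (auto simp: X_def)
  qed
  with \<open>T \<in> X\<close> obtain M where "M \<in> X" and max: "\<forall>M'\<in>X. M \<subseteq> M' \<longrightarrow> M' = M"
    using subset_Zorn_nonempty[of X] by blast
  then have M: "closed_theory L M" "T \<subseteq> M" "G \<notin> M" by (auto simp: X_def)
  have prv: "L \<turnstile> A \<Longrightarrow> A \<in> M" and mp: "A \<^bold>\<longrightarrow> B \<in> M \<Longrightarrow> A \<in> M \<Longrightarrow> B \<in> M" for A B
    using M(1) by (auto simp: closed_theory_def)
  have ext: "B \<^bold>\<longrightarrow> G \<in> M" if "B \<notin> M" for B
  proof (rule ccontr)
    assume G: "B \<^bold>\<longrightarrow> G \<notin> M"
    \<comment> \<open>By the deduction theorem these are the consequences of \<open>M\<close>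
      together with \<open>B\<close>.\<close>
    define M' where "M' = {D. B \<^bold>\<longrightarrow> D \<in> M}"
    have weak: "D \<in> M \<Longrightarrow> B \<^bold>\<longrightarrow> D \<in> M" for D
      using mp[OF prv[OF taut], of D "B \<^bold>\<longrightarrow> D"] by simp
    have "B \<^bold>\<longrightarrow> E \<in> M" if "B \<^bold>\<longrightarrow> (D \<^bold>\<longrightarrow> E) \<in> M" "B \<^bold>\<longrightarrow> D \<in> M" for D E
    proof -
      have "(B \<^bold>\<longrightarrow> (D \<^bold>\<longrightarrow> E)) \<^bold>\<longrightarrow> ((B \<^bold>\<longrightarrow> D) \<^bold>\<longrightarrow> (B \<^bold>\<longrightarrow> E)) \<in> M"
        by (intro prv taut) simp
      with that mp show ?thesis by blast
    qed
    then have "closed_theory L M'"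
      unfolding closed_theory_def M'_def using weak prv by blast
    moreover have "M \<subseteq> M'" using weak by (auto simp: M'_def)
    ultimately have "M' \<in> X" using G M by (auto simp: X_def M'_def)
    then have "M' = M" using max \<open>M \<subseteq> M'\<close> by blast
    moreover have "B \<in> M'" unfolding M'_def using prv[OF taut] by simp
    ultimately show False using that by simp
  qed
  have "\<^bold>\<bottom> \<notin> M"
    using mp[OF prv[OF taut], of "\<^bold>\<bottom>" G] M(3) by auto
  moreover have "B \<in> M \<or> \<^bold>\<not> B \<in> M" for B
  proof (rule ccontr)
    assume "\<not> ?thesis"
    then have "B \<^bold>\<longrightarrow> G \<in> M" "\<^bold>\<not> B \<^bold>\<longrightarrow> G \<in> M" using ext by auto
    moreover have "(B \<^bold>\<longrightarrow> G) \<^bold>\<longrightarrow> ((\<^bold>\<not> B \<^bold>\<longrightarrow> G) \<^bold>\<longrightarrow> G) \<in> M"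
      by (intro prv taut) auto
    ultimately show False using mp M(3) by blast
  qed
  ultimately have "mcs L M" using M(1) by (simp add: mcs_def)
  with M show ?thesis using that by blast
qed

lemma mcs_avoiding:
  assumes "\<not> L \<turnstile> A"
  obtains M where "mcs L M" "A \<notin> M"
proof -
  have "closed_theory L {B. L \<turnstile> B}"
    by (auto simp: closed_theory_def intro: provable.MP)
  with assms show ?thesis using lindenbaum that by blast
qed

text \<open>Replaces derivations in the calculus by reasoning inside an arbitrary maximal consistent
  set.\<close>

lemma provable_if_mcs: "(\<And>M. mcs L M \<Longrightarrow> A \<in> M) \<Longrightarrow> L \<turnstile> A"
  using mcs_avoiding by blast

lemma mcs_thm: "mcs L M \<Longrightarrow> L \<turnstile> A \<Longrightarrow> A \<in> M"
  by (simp add: mcs_def closed_theory_def)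

lemma mcs_mp: "mcs L M \<Longrightarrow> A \<^bold>\<longrightarrow> B \<in> M \<Longrightarrow> A \<in> M \<Longrightarrow> B \<in> M"
  unfolding mcs_def closed_theory_def by blast

lemma mcs_thm_mp: "mcs L M \<Longrightarrow> L \<turnstile> A \<^bold>\<longrightarrow> B \<Longrightarrow> A \<in> M \<Longrightarrow> B \<in> M"
  using mcs_thm mcs_mp by blast

lemma mcs_Bot [simp]: "mcs L M \<Longrightarrow> \<^bold>\<bottom> \<notin> M"
  by (simp add: mcs_def)

lemma mcs_Top [simp]: "mcs L M \<Longrightarrow> \<^bold>\<top> \<in> M"
  by (intro mcs_thm taut) simp_all

lemma mcs_Neg [simp]:
  assumes "mcs L M" shows "\<^bold>\<not> A \<in> M \<longleftrightarrow> A \<notin> M"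
proof -
  have "\<^bold>\<not> A \<^bold>\<longrightarrow> (A \<^bold>\<longrightarrow> \<^bold>\<bottom>) \<in> M"
    by (intro mcs_thm[OF assms] taut) simp
  then show ?thesis
    using assms mcs_mp[OF assms] mcs_Bot by (metis mcs_def)
qed

lemma mcs_Imp [simp]:
  assumes "mcs L M" shows "A \<^bold>\<longrightarrow> B \<in> M \<longleftrightarrow> (A \<in> M \<longrightarrow> B \<in> M)"
proof -
  have "\<^bold>\<not> A \<^bold>\<longrightarrow> (A \<^bold>\<longrightarrow> B) \<in> M" "B \<^bold>\<longrightarrow> (A \<^bold>\<longrightarrow> B) \<in> M"
    by (intro mcs_thm[OF assms] taut; simp)+
  then show ?thesis
    using mcs_mp[OF assms] mcs_Neg[OF assms] by blast
qed

lemma mcs_And [simp]: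
  assumes "mcs L M" shows "A \<^bold>\<and> B \<in> M \<longleftrightarrow> A \<in> M \<and> B \<in> M"
proof -
  have "A \<^bold>\<and> B \<^bold>\<longrightarrow> A \<in> M" "A \<^bold>\<and> B \<^bold>\<longrightarrow> B \<in> M" "A \<^bold>\<longrightarrow> (B \<^bold>\<longrightarrow> A \<^bold>\<and> B) \<in> M"
    by (intro mcs_thm[OF assms] taut; simp)+
  then show ?thesis using assms by auto
qed

lemma mcs_Or [simp]:
  assumes "mcs L M" shows "A \<^bold>\<or> B \<in> M \<longleftrightarrow> A \<in> M \<or> B \<in> M"
proof -
  have "A \<^bold>\<longrightarrow> A \<^bold>\<or> B \<in> M" "B \<^bold>\<longrightarrow> A \<^bold>\<or> B \<in> M" "A \<^bold>\<or> B \<^bold>\<longrightarrow> (\<^bold>\<not> A \<^bold>\<longrightarrow> B) \<in> M"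
    by (intro mcs_thm[OF assms] taut; simp)+
  then show ?thesis using assms by auto
qed

lemma mcs_IL: "mcs L M \<Longrightarrow> A \<in> ILminus_axioms \<Longrightarrow> A \<in> M"
  using IL mcs_thm provable.Axiom by blast

lemma mcs_Box_mono:
  assumes M: "mcs L M" and "L \<turnstile> A \<^bold>\<longrightarrow> B" and "\<^bold>\<box> A \<in> M"
  shows "\<^bold>\<box> B \<in> M"
  using mcs_thm[OF M provable.Nec[OF assms(2)]] mcs_IL[OF M ILminus_axioms.K[of A B]] assms(3) M
  by simp

text \<open>Transitivity follows from Loeb's axiom for the conjunction \<open>?B\<close> of
  \<open>A\<close> and \<box> A: since \<open>A\<close> implies \<box> ?B \<longrightarrow> ?B,
  \<box> A yields \<box> ?B.\<close>

lemma mcs_Box_trans: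
  assumes M: "mcs L M" and A: "\<^bold>\<box> A \<in> M"
  shows "\<^bold>\<box> \<^bold>\<box> A \<in> M"
proof -
  let ?B = "A \<^bold>\<and> \<^bold>\<box> A"
  have BA: "L \<turnstile> ?B \<^bold>\<longrightarrow> A" by (rule taut) simp
  have "L \<turnstile> A \<^bold>\<longrightarrow> (\<^bold>\<box> ?B \<^bold>\<longrightarrow> ?B)"
    by (rule provable_if_mcs) (use mcs_Box_mono BA in auto)
  then have "\<^bold>\<box> (\<^bold>\<box> ?B \<^bold>\<longrightarrow> ?B) \<in> M" using mcs_Box_mono M A by blast
  then have "\<^bold>\<box> ?B \<in> M" using mcs_IL[OF M ILminus_axioms.Loeb[of ?B]] M by simp
  then show ?thesis by (rule mcs_Box_mono[OF M, rotated]) (auto intro: taut)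
qed

lemma mcs_Rhd_left:
  "mcs L M \<Longrightarrow> L \<turnstile> A \<^bold>\<longrightarrow> B \<Longrightarrow> B \<^bold>\<rhd> C \<in> M \<Longrightarrow> A \<^bold>\<rhd> C \<in> M"
  using provable.R2 mcs_thm_mp by blast

lemma mcs_Rhd_right:
  "mcs L M \<Longrightarrow> L \<turnstile> A \<^bold>\<longrightarrow> B \<Longrightarrow> C \<^bold>\<rhd> A \<in> M \<Longrightarrow> C \<^bold>\<rhd> B \<in> M"
  using provable.R1 mcs_thm_mp by blast

lemma mcs_Rhd_Or:
  "mcs L M \<Longrightarrow> A \<^bold>\<rhd> C \<in> M \<Longrightarrow> B \<^bold>\<rhd> C \<in> M \<Longrightarrow> (A \<^bold>\<or> B) \<^bold>\<rhd> C \<in> M"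
  using mcs_IL[OF _ ILminus_axioms.J3[of A C B]] by simp

lemma mcs_Rhd_Bot: "mcs L M \<Longrightarrow> (\<^bold>\<not> A) \<^bold>\<rhd> \<^bold>\<bottom> \<in> M \<longleftrightarrow> \<^bold>\<box> A \<in> M"
  using mcs_IL[OF _ ILminus_axioms.J6[of A]] by auto

text \<open>By \<open>J6\<close> this starts from (\<not> A) \<rhd> \<bottom>, and \<bottom> implies
  every \<open>C\<close>.\<close>

lemma mcs_Box_Rhd: "mcs L M \<Longrightarrow> \<^bold>\<box> A \<in> M \<Longrightarrow> (\<^bold>\<not> A) \<^bold>\<rhd> C \<in> M"
  using mcs_Rhd_right[of M "\<^bold>\<bottom>" C] mcs_Rhd_Bot taut by simp

end

section \<open>Critical successors from \<open>J2\<close> and \<open>J5\<close>\<close>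

locale extension_J2_J5 = extension +
  assumes J2: "J2 \<subseteq> L" and J5: "J5 \<subseteq> L"
begin

lemma mcs_Rhd_trans:
  assumes M: "mcs L M" and "A \<^bold>\<rhd> B \<in> M" "B \<^bold>\<rhd> C \<in> M"
  shows "A \<^bold>\<rhd> C \<in> M"
proof -
  have "((A \<^bold>\<rhd> B) \<^bold>\<and> (B \<^bold>\<rhd> C)) \<^bold>\<longrightarrow> (A \<^bold>\<rhd> C) \<in> L"
    using J2 by (auto simp: J2_def)
  then have "((A \<^bold>\<rhd> B) \<^bold>\<and> (B \<^bold>\<rhd> C)) \<^bold>\<longrightarrow> (A \<^bold>\<rhd> C) \<in> M"
    by (intro mcs_thm[OF M] provable.Axiom)
  then show ?thesis using assms by simp
qed

lemma mcs_Dia_Rhd: "mcs L M \<Longrightarrow> (\<^bold>\<diamond> A) \<^bold>\<rhd> A \<in> M"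
  by (erule mcs_thm, rule provable.Axiom) (use J5 in \<open>auto simp: J5_def\<close>)

text \<open>The formulas \<open>F\<close> with \<open>\<^bold>\<not> F \<^bold>\<rhd> C \<in> M\<close> form a theory by \<open>J3\<close>, and any maximal consistent
  extension of it is a \<open>C\<close>-critical successor of \<open>M\<close>.\<close>

lemma critical_successor:
  assumes M: "mcs L M" and G: "(\<^bold>\<not> G) \<^bold>\<rhd> C \<notin> M"
  obtains N where "mcs L N" "G \<notin> N" "\<^bold>\<box> G \<in> N" "\<^bold>\<box> G \<notin> M" "\<^bold>\<box> \<^bold>\<not> C \<in> N"
    "\<forall>F. \<^bold>\<box> F \<in> M \<longrightarrow> F \<in> N \<and> \<^bold>\<box> F \<in> N"
    "\<forall>E. E \<^bold>\<rhd> C \<in> M \<longrightarrow> E \<notin> N \<and> \<^bold>\<box> \<^bold>\<not> E \<in> N"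
proof -
  define T where "T = {F. (\<^bold>\<not> F) \<^bold>\<rhd> C \<in> M}"
  have box: "F \<in> T" if "\<^bold>\<box> F \<in> M" for F
    using mcs_Box_Rhd[OF M that] by (simp add: T_def)
  have T: "closed_theory L T"
    unfolding closed_theory_def
  proof (intro conjI allI impI)
    fix A assume "L \<turnstile> A"
    then show "A \<in> T" by (intro box mcs_thm[OF M] provable.Nec)
  next
    fix A B assume "A \<^bold>\<longrightarrow> B \<in> T" "A \<in> T"
    then have "(\<^bold>\<not> (A \<^bold>\<longrightarrow> B) \<^bold>\<or> \<^bold>\<not> A) \<^bold>\<rhd> C \<in> M"
      using mcs_Rhd_Or[OF M] by (simp add: T_def)
    then show "B \<in> T"
      unfolding T_def mem_Collect_eq by (rule mcs_Rhd_left[OF M, rotated]) (auto intro: taut)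
  qed
  \<comment> \<open>Refuting \<box> G \<longrightarrow> G rather than only \<open>G\<close> puts
    \<box> G into \<open>N\<close> while it is missing from \<open>M\<close>; this makes the step to
    \<open>N\<close> strict.\<close>
  let ?K = "\<^bold>\<not> (\<^bold>\<box> G \<^bold>\<longrightarrow> G)"
  have "\<^bold>\<box> G \<^bold>\<longrightarrow> G \<notin> T"
  proof
    assume "\<^bold>\<box> G \<^bold>\<longrightarrow> G \<in> T"
    then have K: "?K \<^bold>\<rhd> C \<in> M" by (simp add: T_def)
    then have "(\<^bold>\<diamond> ?K) \<^bold>\<rhd> C \<in> M"
      using mcs_Rhd_trans[OF M] mcs_Dia_Rhd[OF M] by blast
    with K have KK: "(?K \<^bold>\<or> \<^bold>\<diamond> ?K) \<^bold>\<rhd> C \<in> M" using mcs_Rhd_Or[OF M] by blast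
    \<comment> \<open>Loeb's axiom in contrapositive form: where \<open>?K\<close> and \<diamond> ?K
      both fail, \<box> (\<box> G \<longrightarrow> G) holds, hence \<box> G, hence
      \<open>G\<close>.\<close>
    have "L \<turnstile> \<^bold>\<not> G \<^bold>\<longrightarrow> (?K \<^bold>\<or> \<^bold>\<diamond> ?K)"
    proof (rule provable_if_mcs)
      fix N assume N: "mcs L N"
      have "\<^bold>\<box> (\<^bold>\<box> G \<^bold>\<longrightarrow> G) \<in> N" if "\<^bold>\<box> \<^bold>\<not> ?K \<in> N"
        using that by (rule mcs_Box_mono[OF N, rotated]) (auto intro: taut)
      then show "\<^bold>\<not> G \<^bold>\<longrightarrow> (?K \<^bold>\<or> \<^bold>\<diamond> ?K) \<in> N"
        using N mcs_IL[OF N ILminus_axioms.Loeb[of G]] by auto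
    qed
    with KK G show False using mcs_Rhd_left[OF M] by blast
  qed
  then obtain N where N: "mcs L N" "T \<subseteq> N" "\<^bold>\<box> G \<^bold>\<longrightarrow> G \<notin> N"
    using lindenbaum[OF T] by blast
  show ?thesis
  proof
    show "mcs L N" by fact
    show "G \<notin> N" "\<^bold>\<box> G \<in> N" using N by auto
    show "\<^bold>\<box> G \<notin> M" using G mcs_Box_Rhd[OF M] by blast
    have "\<^bold>\<box> \<^bold>\<not> C \<in> T" using mcs_Dia_Rhd[OF M] by (simp add: T_def)
    then show "\<^bold>\<box> \<^bold>\<not> C \<in> N" using N by blast
    show "\<forall>F. \<^bold>\<box> F \<in> M \<longrightarrow> F \<in> N \<and> \<^bold>\<box> F \<in> N"
    proof (intro allI impI)
      fix F assume F: "\<^bold>\<box> F \<in> M"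
      show "F \<in> N \<and> \<^bold>\<box> F \<in> N"
        using box[OF F] box[OF mcs_Box_trans[OF M F]] N(2) by blast
    qed
    show "\<forall>E. E \<^bold>\<rhd> C \<in> M \<longrightarrow> E \<notin> N \<and> \<^bold>\<box> \<^bold>\<not> E \<in> N"
    proof (intro allI impI)
      fix E assume E: "E \<^bold>\<rhd> C \<in> M"
      have "\<^bold>\<not> E \<in> T"
        unfolding T_def mem_Collect_eq
        using E by (rule mcs_Rhd_left[OF M, rotated]) (auto intro: taut)
      \<comment> \<open>\<open>J5\<close> composed with \<open>E\<close> \<rhd> \<open>C\<close> by
        \<open>J2\<close> gives \<diamond> E \<rhd> C, which is exactly this membership.\<close>
      moreover have "\<^bold>\<box> \<^bold>\<not> E \<in> T"
        using mcs_Rhd_trans[OF M mcs_Dia_Rhd[OF M] E] by (simp add: T_def)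
      ultimately show "E \<notin> N \<and> \<^bold>\<box> \<^bold>\<not> E \<in> N" using N(2) mcs_Neg[OF N(1)] by blast
    qed
  qed
qed

end

section \<open>The finite canonical frame\<close>

primrec subfms :: "fm \<Rightarrow> fm set" where
  "subfms (Var n) = {Var n}"
| "subfms \<^bold>\<top> = {\<^bold>\<top>}"
| "subfms \<^bold>\<bottom> = {\<^bold>\<bottom>}"
| "subfms (\<^bold>\<not> A) = insert (\<^bold>\<not> A) (subfms A)"
| "subfms (A \<^bold>\<and> B) = insert (A \<^bold>\<and> B) (subfms A \<union> subfms B)"
| "subfms (A \<^bold>\<or> B) = insert (A \<^bold>\<or> B) (subfms A \<union> subfms B)"
| "subfms (A \<^bold>\<longrightarrow> B) = insert (A \<^bold>\<longrightarrow> B) (subfms A \<union> subfms B)"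
| "subfms (\<^bold>\<box> A) = insert (\<^bold>\<box> A) (subfms A)"
| "subfms (A \<^bold>\<rhd> B) = insert (A \<^bold>\<rhd> B) (subfms A \<union> subfms B)"

lemma finite_subfms [simp]: "finite (subfms A)"
  by (induction A) auto

lemma subfms_refl [simp]: "A \<in> subfms A"
  by (induction A) auto

lemma subfms_trans: "B \<in> subfms A \<Longrightarrow> C \<in> subfms B \<Longrightarrow> C \<in> subfms A"
  by (induction A) auto

text \<open>The last set in \<open>L_subset\<close> is \<open>J4plus\<close> if \<open>L\<close>
  contains the whole schema and empty otherwise, so one construction covers both logics.\<close>

locale canonical = extension_J2_J5 +
  fixes A0 :: fm
  assumes L_subset: "L \<subseteq> ILminus_axioms \<union> J2 \<union> J5 \<union> {B \<in> J4plus. J4plus \<subseteq> L}"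
begin

abbreviation S :: "fm set" where "S \<equiv> subfms A0"

text \<open>The negations serve \<box> \<not> E in \<open>critical\<close> and successors satisfying
  a given subformula; the implications serve the witness with \<open>B\<close> but without
  \<open>C\<close> under \<open>J4plus\<close>.\<close>

definition boxed :: "fm set" where
  "boxed = S \<union> Neg ` S \<union> (\<lambda>(B, C). B \<^bold>\<longrightarrow> C) ` (S \<times> S)"

definition \<Phi> :: "fm set" where
  "\<Phi> = boxed \<union> Box ` boxed \<union> (\<lambda>(B, C). B \<^bold>\<rhd> C) ` (S \<times> S)"

definition prec :: "fm set \<Rightarrow> fm set \<Rightarrow> bool" where
  "prec \<Gamma> \<Delta> \<longleftrightarrow> (\<forall>G\<in>boxed. \<^bold>\<box> G \<in> \<Gamma> \<longrightarrow> G \<in> \<Delta> \<and> \<^bold>\<box> G \<in> \<Delta>) \<and>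
     (\<exists>G\<in>boxed. \<^bold>\<box> G \<in> \<Delta> \<and> \<^bold>\<box> G \<notin> \<Gamma>)"

text \<open>Although \<open>C\<close> may hold at \<Delta>, the condition \<box> \<not> C makes it
  fail at everything beyond; validity of \<open>J5\<close> rests on this.\<close>

definition critical :: "fm \<Rightarrow> fm set \<Rightarrow> fm set \<Rightarrow> bool" where
  "critical C \<Gamma> \<Delta> \<longleftrightarrow> prec \<Gamma> \<Delta> \<and> \<^bold>\<box> \<^bold>\<not> C \<in> \<Delta> \<and>
     (\<forall>E\<in>S. E \<^bold>\<rhd> C \<in> \<Gamma> \<longrightarrow> E \<notin> \<Delta> \<and> \<^bold>\<box> \<^bold>\<not> E \<in> \<Delta>)"

text \<open>The bound on the length of the label keeps the frame finite; it leaves room for one more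
  entry in every successor, because \<open>prec\<close> strictly increases the number of boxed formulas.\<close>

definition W :: "(fm set \<times> fm list) set" where
  "W = {(M \<inter> \<Phi>, \<tau>) | M \<tau>. mcs L M \<and> set \<tau> \<subseteq> S \<and> length \<tau> \<le> card {G \<in> boxed. \<^bold>\<box> G \<in> M}}"

definition R :: "((fm set \<times> fm list) \<times> (fm set \<times> fm list)) set" where
  "R = {(x, y). x \<in> W \<and> y \<in> W \<and> prec (fst x) (fst y) \<and> (\<exists>C \<rho>. snd y = snd x @ C # \<rho>)}"

text \<open>The first entry beyond the label of \<open>x\<close> fixes the formula, so a world is
  critical over \<open>x\<close> for at most one \<open>C\<close>.\<close>

definition crit :: "fm set \<times> fm list \<Rightarrow> fm \<Rightarrow> (fm set \<times> fm list) set" where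
  "crit x C = {y. (x, y) \<in> R \<and> critical C (fst x) (fst y) \<and> (\<exists>\<rho>. snd y = snd x @ C # \<rho>)}"

text \<open>Meeting the successors of \<open>x\<close> is demanded over noncritical \<open>y\<close>
  as well: composition along \<open>J2\<close> can continue only from successors of
  \<open>x\<close>.\<close>

definition SR :: "fm set \<times> fm list \<Rightarrow> ((fm set \<times> fm list) \<times> (fm set \<times> fm list) set) set" where
  "SR x = {(y, V). (x, y) \<in> R \<and> V \<subseteq> W \<and> V \<inter> R `` {x} \<noteq> {} \<and>
     (\<forall>C. y \<in> crit x C \<longrightarrow> V \<inter> crit x C \<noteq> {} \<and>
        (\<exists>z\<in>V. C \<notin> fst z \<and> (J4plus \<subseteq> L \<longrightarrow> (x, z) \<in> R)))}"

definition FR :: "(fm set \<times> fm list) frame" where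
  "FR = \<lparr>Worlds = W, Rel = R, Srel = SR\<rparr>"

declare split_paired_All [simp del] split_paired_Ex [simp del]

lemma FR_sel [simp]: "Worlds FR = W" "Rel FR = R" "Srel FR = SR"
  by (simp_all add: FR_def)

section \<open>Finiteness, order properties and inheritance of criticality\<close>

lemma finite_boxed: "finite boxed"
  by (simp add: boxed_def)

lemma finite_Phi: "finite \<Phi>"
  by (simp add: \<Phi>_def finite_boxed)

lemma finite_W: "finite W"
proof -
  have "W \<subseteq> Pow \<Phi> \<times> {\<tau>. set \<tau> \<subseteq> S \<and> length \<tau> \<le> card boxed}"
    unfolding W_def using card_mono[OF finite_boxed, of "{G \<in> boxed. _ G}"]
    by (fastforce intro: order_trans)
  then show ?thesis
    by (rule finite_subset) (simp add: finite_Phi finite_lists_length_le)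
qed

lemma R_W: "(x, y) \<in> R \<Longrightarrow> x \<in> W \<and> y \<in> W"
  by (simp add: R_def)

lemma crit_R: "y \<in> crit x C \<Longrightarrow> (x, y) \<in> R"
  by (simp add: crit_def)

lemma prec_trans: "prec \<Gamma> \<Delta> \<Longrightarrow> prec \<Delta> \<Theta> \<Longrightarrow> prec \<Gamma> \<Theta>"
  unfolding prec_def by blast

lemma trans_R: "trans R"
proof (rule transI)
  fix x y z assume xy: "(x, y) \<in> R" and yz: "(y, z) \<in> R"
  then obtain C \<rho> D \<rho>' where "snd y = snd x @ C # \<rho>" "snd z = snd y @ D # \<rho>'"
    by (auto simp: R_def)
  then have "snd z = snd x @ C # (\<rho> @ D # \<rho>')" by simp
  then show "(x, z) \<in> R" using xy yz prec_trans unfolding R_def by blast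
qed

text \<open>By transitivity a cycle would be a loop, which the new boxed formula in
  \<open>prec\<close> excludes; finiteness then gives converse well-foundedness.\<close>

lemma wf_R: "wf (R\<inverse>)"
proof (rule finite_acyclic_wf_converse)
  have "R \<subseteq> W \<times> W" using R_W by auto
  then show "finite R" using finite_W finite_subset by blast
  show "acyclic R"
    unfolding acyclic_def using trans_R by (auto simp: R_def prec_def)
qed

lemma boxedI: "B \<in> S \<Longrightarrow> B \<in> boxed" "B \<in> S \<Longrightarrow> \<^bold>\<not> B \<in> boxed"
  "B \<in> S \<Longrightarrow> C \<in> S \<Longrightarrow> B \<^bold>\<longrightarrow> C \<in> boxed"
  by (auto simp: boxed_def)

lemma PhiI: "G \<in> boxed \<Longrightarrow> G \<in> \<Phi>" "G \<in> boxed \<Longrightarrow> \<^bold>\<box> G \<in> \<Phi>"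
  "B \<in> S \<Longrightarrow> C \<in> S \<Longrightarrow> B \<^bold>\<rhd> C \<in> \<Phi>"
  by (auto simp: \<Phi>_def)

lemma label_in_S: "y \<in> crit x C \<Longrightarrow> C \<in> S"
  by (auto simp: crit_def R_def W_def)

text \<open>From \<box> \<not> E, \<open>prec\<close> passes on both \<not> E and \<box> \<not> E,
  so criticality is inherited. For \<open>C\<close> itself this gives its failure at
  \<open>z\<close>.\<close>

lemma crit_R_trans:
  assumes y: "y \<in> crit x C" and yz: "(y, z) \<in> R"
  shows "z \<in> crit x C" and "C \<notin> fst z"
proof -
  have xy: "(x, y) \<in> R" and cr: "critical C (fst x) (fst y)" and "\<exists>\<rho>. snd y = snd x @ C # \<rho>"
    using y by (auto simp: crit_def)
  moreover have pr: "prec (fst y) (fst z)" and "\<exists>D \<rho>. snd z = snd y @ D # \<rho>" "z \<in> W"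
    using yz by (auto simp: R_def)
  moreover have xz: "(x, z) \<in> R" using trans_R xy yz by (rule transD)
  moreover have step: "E \<notin> fst z \<and> \<^bold>\<box> \<^bold>\<not> E \<in> fst z" if "\<^bold>\<box> \<^bold>\<not> E \<in> fst y" "E \<in> S" for E
  proof -
    have "\<^bold>\<not> E \<in> fst z" "\<^bold>\<box> \<^bold>\<not> E \<in> fst z"
      using pr that boxedI(2) by (auto simp: prec_def)
    then show ?thesis using \<open>z \<in> W\<close> by (auto simp: W_def)
  qed
  ultimately show "z \<in> crit x C" "C \<notin> fst z"
    using label_in_S[OF y] by (auto simp: crit_def critical_def R_def)
qed

section \<open>Frame conditions and validity of the axioms\<close>

lemma ILS_frame_FR:
  assumes "W \<noteq> {}"
  shows "ILS_frame FR"
proof -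
  have "R \<subseteq> W \<times> W" using R_W by auto
  moreover have "SR x \<subseteq> W \<times> (Pow W - {{}})" for x
    using R_W by (auto simp: SR_def)
  moreover have "(x, y) \<in> R" if "(y, V) \<in> SR x" for x y V
    using that by (simp add: SR_def)
  moreover have "(y, U) \<in> SR x" if "(y, V) \<in> SR x \<and> V \<subseteq> U \<and> U \<subseteq> W" for x y V U
    using that unfolding SR_def by blast
  ultimately show ?thesis
    unfolding ILS_frame_def FR_sel using assms trans_R wf_R by blast
qed

text \<open>Both witnesses survive the cut: critical worlds are successors of \<open>x\<close> by
  definition, and under \<open>J4plus\<close> so is the world without \<open>C\<close>.\<close>

lemma SR_J4plus:
  assumes "J4plus \<subseteq> L" "(y, V) \<in> SR x"
  shows "(y, V \<inter> R `` {x}) \<in> SR x"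
proof -
  have "V \<inter> R `` {x} \<inter> crit x C = V \<inter> crit x C" for C
    using crit_R by blast
  with assms show ?thesis unfolding SR_def by simp blast
qed

text \<open>If \<open>y\<close> is \<open>C\<close>-critical, \<open>z\<close> inherits criticality
  and lacks \<open>C\<close>, so this one world is both witnesses.\<close>

lemma SR_J5: "(x, y) \<in> R \<Longrightarrow> (y, z) \<in> R \<Longrightarrow> (y, {z}) \<in> SR x"
  using crit_R_trans[of y x _ z] R_W[of y z] transD[OF trans_R, of x y z] by (auto simp: SR_def)

text \<open>The union runs over the successors of \<open>x\<close> in \<open>V\<close>, the only
  members to which a formula B \<rhd> C true at \<open>x\<close> applies. Over a
  \<open>C\<close>-critical \<open>y\<close>, some \<open>w\<close> in \<open>V\<close> is
  \<open>C\<close>-critical, and \<open>U w\<close> supplies both witnesses.\<close>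

lemma SR_J2:
  assumes yV: "(y, V) \<in> SR x" and U: "\<And>z. z \<in> V \<Longrightarrow> (x, z) \<in> R \<Longrightarrow> (z, U z) \<in> SR x"
  shows "(y, \<Union> (U ` (V \<inter> R `` {x}))) \<in> SR x" (is "(y, ?U) \<in> _")
proof -
  have xy: "(x, y) \<in> R" using yV by (simp add: SR_def)
  have U': "U z \<subseteq> W \<and> U z \<inter> R `` {x} \<noteq> {}" if "z \<in> V" "(x, z) \<in> R" for z
    using U[OF that] by (simp add: SR_def)
  then have sub: "?U \<subseteq> W" by blast
  obtain z where "z \<in> V" "(x, z) \<in> R" using yV by (auto simp: SR_def)
  moreover from this have "U z \<inter> R `` {x} \<noteq> {}" using U' by blast
  ultimately have ne: "?U \<inter> R `` {x} \<noteq> {}" by blast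
  have "?U \<inter> crit x C \<noteq> {} \<and> (\<exists>z\<in>?U. C \<notin> fst z \<and> (J4plus \<subseteq> L \<longrightarrow> (x, z) \<in> R))"
    if "y \<in> crit x C" for C
  proof -
    have "V \<inter> crit x C \<noteq> {}" using yV that by (simp add: SR_def)
    then obtain w where w: "w \<in> V" "w \<in> crit x C" by blast
    with U have "(w, U w) \<in> SR x" using crit_R by blast
    with w have "U w \<inter> crit x C \<noteq> {} \<and> (\<exists>z\<in>U w. C \<notin> fst z \<and> (J4plus \<subseteq> L \<longrightarrow> (x, z) \<in> R))"
      by (simp add: SR_def)
    with w crit_R show ?thesis by blast
  qed
  with xy sub ne show ?thesis by (simp add: SR_def)
qed

lemma sat_Rhd_FR:
  "sat FR \<nu> x (A \<^bold>\<rhd> B) \<longleftrightarrow>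
     (\<forall>y. (x, y) \<in> R \<longrightarrow> sat FR \<nu> y A \<longrightarrow> (\<exists>V. (y, V) \<in> SR x \<and> (\<forall>z\<in>V. sat FR \<nu> z B)))"
proof -
  have "(\<exists>V. V \<subseteq> W \<and> (y, V) \<in> SR x \<and> P V) \<longleftrightarrow> (\<exists>V. (y, V) \<in> SR x \<and> P V)" for y P
    by (auto simp: SR_def)
  then show ?thesis by (simp add: imp_conjL)
qed

lemma valid_J2_FR: "valid FR ((A \<^bold>\<rhd> B) \<^bold>\<and> (B \<^bold>\<rhd> C) \<^bold>\<longrightarrow> A \<^bold>\<rhd> C)"
proof -
  have "sat FR \<nu> x (A \<^bold>\<rhd> C)" if AB: "sat FR \<nu> x (A \<^bold>\<rhd> B)" and BC: "sat FR \<nu> x (B \<^bold>\<rhd> C)" for \<nu> x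
    unfolding sat_Rhd_FR
  proof (intro allI impI)
    fix y assume y: "(x, y) \<in> R" "sat FR \<nu> y A"
    obtain V where V: "(y, V) \<in> SR x" "\<forall>z\<in>V. sat FR \<nu> z B"
      using AB y unfolding sat_Rhd_FR by blast
    have "\<forall>z\<in>V. (x, z) \<in> R \<longrightarrow> (\<exists>U. (z, U) \<in> SR x \<and> (\<forall>u\<in>U. sat FR \<nu> u C))"
      using BC V(2) unfolding sat_Rhd_FR by blast
    then obtain U where U: "\<And>z. z \<in> V \<Longrightarrow> (x, z) \<in> R \<Longrightarrow>
        (z, U z) \<in> SR x \<and> (\<forall>u\<in>U z. sat FR \<nu> u C)"
      by metis
    then have "(y, \<Union> (U ` (V \<inter> R `` {x}))) \<in> SR x"
      using SR_J2[OF V(1)] by blast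
    with U show "\<exists>V. (y, V) \<in> SR x \<and> (\<forall>z\<in>V. sat FR \<nu> z C)" by blast
  qed
  then show ?thesis unfolding valid_def sat.simps(5,7) by blast
qed

lemma valid_J5_FR: "valid FR ((\<^bold>\<diamond> A) \<^bold>\<rhd> A)"
proof -
  have "sat FR \<nu> x ((\<^bold>\<diamond> A) \<^bold>\<rhd> A)" for \<nu> x
    unfolding sat_Rhd_FR
  proof (intro allI impI)
    fix y assume "(x, y) \<in> R" "sat FR \<nu> y (\<^bold>\<diamond> A)"
    then obtain z where "(y, z) \<in> R" "sat FR \<nu> z A" by auto
    with \<open>(x, y) \<in> R\<close> show "\<exists>V. (y, V) \<in> SR x \<and> (\<forall>z\<in>V. sat FR \<nu> z A)"
      using SR_J5[of x y z] by blast
  qed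
  then show ?thesis unfolding valid_def by blast
qed

lemma valid_J4plus_FR:
  assumes "J4plus \<subseteq> L"
  shows "valid FR (\<^bold>\<box> (A \<^bold>\<longrightarrow> B) \<^bold>\<longrightarrow> (C \<^bold>\<rhd> A \<^bold>\<longrightarrow> C \<^bold>\<rhd> B))"
proof -
  have "sat FR \<nu> x (C \<^bold>\<rhd> B)" if AB: "sat FR \<nu> x (\<^bold>\<box> (A \<^bold>\<longrightarrow> B))" and CA: "sat FR \<nu> x (C \<^bold>\<rhd> A)" for \<nu> x
    unfolding sat_Rhd_FR
  proof (intro allI impI)
    fix y assume y: "(x, y) \<in> R" "sat FR \<nu> y C"
    obtain V where V: "(y, V) \<in> SR x" "\<forall>z\<in>V. sat FR \<nu> z A"
      using CA y unfolding sat_Rhd_FR by blast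
    have "\<forall>z\<in>V \<inter> R `` {x}. sat FR \<nu> z B" using V(2) AB by simp
    with SR_J4plus[OF assms V(1)] show "\<exists>V. (y, V) \<in> SR x \<and> (\<forall>z\<in>V. sat FR \<nu> z B)" by blast
  qed
  then show ?thesis unfolding valid_def sat.simps(7) by blast
qed

lemma ILS_frame_of_FR:
  assumes "W \<noteq> {}"
  shows "ILS_frame_of L FR"
  unfolding ILS_frame_of_def
proof (intro conjI ballI)
  show F: "ILS_frame FR" using assms by (rule ILS_frame_FR)
  fix B assume "B \<in> L"
  then consider "B \<in> ILminus_axioms" | "B \<in> J2" | "B \<in> J5" | "B \<in> J4plus" "J4plus \<subseteq> L"
    using L_subset by blast
  then show "valid FR B"
  proof cases
    case 1
    with F show ?thesis by (rule valid_ILminus_axioms)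
  next
    case 2
    then show ?thesis unfolding J2_def using valid_J2_FR by blast
  next
    case 3
    then show ?thesis unfolding J5_def using valid_J5_FR by blast
  next
    case 4
    then show ?thesis using valid_J4plus_FR[OF 4(2)] by (auto simp: J4plus_def)
  qed
qed

section \<open>Existence of successors\<close>

lemma card_boxed_less:
  assumes "prec M N"
  shows "card {G \<in> boxed. \<^bold>\<box> G \<in> M} < card {G \<in> boxed. \<^bold>\<box> G \<in> N}"
proof (rule psubset_card_mono)
  show "finite {G \<in> boxed. \<^bold>\<box> G \<in> N}" using finite_boxed by simp
  show "{G \<in> boxed. \<^bold>\<box> G \<in> M} \<subset> {G \<in> boxed. \<^bold>\<box> G \<in> N}"
    using assms unfolding prec_def by blast
qed

text \<open>Worlds keep only traces on \<Phi>, but \<Phi> contains every formula that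
  \<open>prec\<close> inspects.\<close>

lemma prec_Int_Phi [simp]: "prec (M \<inter> \<Phi>) (N \<inter> \<Phi>) \<longleftrightarrow> prec M N"
  using PhiI by (auto simp: prec_def)

lemma critical_Int_Phi [simp]:
  assumes "C \<in> S"
  shows "critical C (M \<inter> \<Phi>) (N \<inter> \<Phi>) \<longleftrightarrow> critical C M N"
proof -
  have "E \<in> S \<Longrightarrow> E \<in> \<Phi> \<and> \<^bold>\<box> \<^bold>\<not> E \<in> \<Phi> \<and> E \<^bold>\<rhd> C \<in> \<Phi>" for E
    using PhiI boxedI assms by blast
  then show ?thesis using assms by (auto simp: critical_def)
qed

lemma critical_boxed_successor:
  assumes M: "mcs L M" and G: "G \<in> boxed" "(\<^bold>\<not> G) \<^bold>\<rhd> C \<notin> M"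
  obtains N where "mcs L N" "critical C M N" "G \<notin> N"
proof -
  obtain N where N: "mcs L N" "G \<notin> N" "\<^bold>\<box> G \<in> N" "\<^bold>\<box> G \<notin> M" "\<^bold>\<box> \<^bold>\<not> C \<in> N"
    "\<forall>F. \<^bold>\<box> F \<in> M \<longrightarrow> F \<in> N \<and> \<^bold>\<box> F \<in> N"
    "\<forall>E. E \<^bold>\<rhd> C \<in> M \<longrightarrow> E \<notin> N \<and> \<^bold>\<box> \<^bold>\<not> E \<in> N"
    using critical_successor[OF M G(2)] .
  have "prec M N" unfolding prec_def using N(3,4,6) G(1) by auto
  with N(5,7) have "critical C M N" by (auto simp: critical_def)
  with N(1,2) show ?thesis using that by blast
qed

text \<open>By \<open>J6\<close> this is the case of \<bottom>-critical successors, of which only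
  the \<open>prec\<close> part is kept.\<close>

lemma prec_successor:
  assumes M: "mcs L M" and G: "G \<in> boxed" "\<^bold>\<box> G \<notin> M"
  obtains N where "mcs L N" "prec M N" "G \<notin> N"
proof -
  have "(\<^bold>\<not> G) \<^bold>\<rhd> \<^bold>\<bottom> \<notin> M" using G(2) mcs_Rhd_Bot[OF M] by simp
  with M G(1) obtain N where "mcs L N" "critical \<^bold>\<bottom> M N" "G \<notin> N"
    by (rule critical_boxed_successor)
  then show ?thesis using that by (simp add: critical_def)
qed

lemma R_successor:
  assumes "(M \<inter> \<Phi>, \<tau>) \<in> W" "mcs L M" "mcs L N" "prec M N" "C \<in> S"
  shows "((M \<inter> \<Phi>, \<tau>), (N \<inter> \<Phi>, \<tau> @ [C])) \<in> R"
proof -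
  \<comment> \<open>The label bound is known for some \<open>M'\<close> with the same trace as
    \<open>M\<close>. The step to \<open>N\<close> adds at least one boxed formula, which makes room
    for \<open>C\<close>.\<close>
  obtain M' where M': "M \<inter> \<Phi> = M' \<inter> \<Phi>" "set \<tau> \<subseteq> S" "length \<tau> \<le> card {G \<in> boxed. \<^bold>\<box> G \<in> M'}"
    using assms(1) by (auto simp: W_def)
  have "prec M' N" using assms(4) M'(1) prec_Int_Phi by metis
  then have "(N \<inter> \<Phi>, \<tau> @ [C]) \<in> W"
    unfolding W_def mem_Collect_eq using card_boxed_less[of M' N] assms(3,5) M'
    by (intro exI[of _ N] exI[of _ "\<tau> @ [C]"]) auto
  with assms(1,4) show ?thesis by (simp add: R_def)
qed

section \<open>Truth lemma and finite countermodel\<close>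

definition val :: "fm set \<times> fm list \<Rightarrow> nat \<Rightarrow> bool" where
  "val x n \<longleftrightarrow> Var n \<in> fst x"

lemma truth:
  assumes "(M \<inter> \<Phi>, \<tau>) \<in> W" "mcs L M" "B \<in> S"
  shows "sat FR val (M \<inter> \<Phi>, \<tau>) B \<longleftrightarrow> B \<in> M"
  using assms
proof (induction B arbitrary: M \<tau>)
  case (Var n)
  then show ?case using PhiI boxedI by (simp add: val_def)
next
  case (Neg B)
  have "B \<in> S" using Neg.prems by (auto intro: subfms_trans)
  then show ?case using Neg by simp
next
  case (And B C)
  have "B \<in> S" "C \<in> S" using And.prems by (auto intro: subfms_trans)
  then show ?case using And by simp
next
  case (Or B C)
  have "B \<in> S" "C \<in> S" using Or.prems by (auto intro: subfms_trans)
  then show ?case using Or by simp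
next
  case (Imp B C)
  have "B \<in> S" "C \<in> S" using Imp.prems by (auto intro: subfms_trans)
  then show ?case using Imp by simp
next
  case (Box B)
  note x = Box.prems(1) and M = Box.prems(2)
  have B: "B \<in> S" using Box.prems by (auto intro: subfms_trans)
  show ?case
  proof
    assume *: "sat FR val (M \<inter> \<Phi>, \<tau>) (\<^bold>\<box> B)"
    show "\<^bold>\<box> B \<in> M"
    proof (rule ccontr)
      assume "\<^bold>\<box> B \<notin> M"
      then obtain N where N: "mcs L N" "prec M N" "B \<notin> N"
        using prec_successor[OF M] B boxedI by blast
      \<comment> \<open>Any label from \<open>S\<close> would serve here.\<close>
      have R: "((M \<inter> \<Phi>, \<tau>), (N \<inter> \<Phi>, \<tau> @ [B])) \<in> R"
        by (rule R_successor) (use x M N B in auto)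
      then have "sat FR val (N \<inter> \<Phi>, \<tau> @ [B]) B" using * by simp
      with Box.IH R_W[OF R] N B show False by blast
    qed
  next
    assume *: "\<^bold>\<box> B \<in> M"
    have "sat FR val y B" if "((M \<inter> \<Phi>, \<tau>), y) \<in> R" for y
    proof -
      have "y \<in> W" using R_W[OF that] by blast
      then obtain N \<sigma> where y: "y = (N \<inter> \<Phi>, \<sigma>)" "mcs L N"
        by (auto simp: W_def)
      then have "prec M N" using that by (simp add: R_def)
      then have "B \<in> N" using * B boxedI by (auto simp: prec_def)
      with Box.IH R_W[OF that] y B show ?thesis by blast
    qed
    then show "sat FR val (M \<inter> \<Phi>, \<tau>) (\<^bold>\<box> B)" by simp
  qed
next
  case (Rhd A B)
  note M = Rhd.prems(2)
  let ?x = "(M \<inter> \<Phi>, \<tau>)"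
  have A: "A \<in> S" and B: "B \<in> S" using Rhd.prems by (auto intro: subfms_trans)
  note IH = Rhd.IH(1)[OF _ _ A] Rhd.IH(2)[OF _ _ B]
  have succ: "(?x, (N \<inter> \<Phi>, \<tau> @ [C])) \<in> R" if "mcs L N" "prec M N" "C \<in> S" for N C
    by (rule R_successor) (use Rhd.prems that in auto)
  have crit_succ: "(N \<inter> \<Phi>, \<tau> @ [C]) \<in> crit ?x C" if "mcs L N" "critical C M N" "C \<in> S" for N C
    using succ[OF that(1) _ that(3)] that by (simp add: crit_def) (simp add: critical_def)
  show ?case
  proof
    assume sat: "sat FR val ?x (A \<^bold>\<rhd> B)"
    show "A \<^bold>\<rhd> B \<in> M"
    proof (rule ccontr)
      assume "A \<^bold>\<rhd> B \<notin> M"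
      \<comment> \<open>The successor is obtained by refuting a formula from \<open>boxed\<close>;
        here that formula is \<not> A, whence the double negation.\<close>
      then have "(\<^bold>\<not> \<^bold>\<not> A) \<^bold>\<rhd> B \<notin> M"
        using mcs_Rhd_left[OF M, of A "\<^bold>\<not> \<^bold>\<not> A"] taut by auto
      then obtain N where N: "mcs L N" "critical B M N" "\<^bold>\<not> A \<notin> N"
        using critical_boxed_successor[OF M] boxedI A by metis
      let ?y = "(N \<inter> \<Phi>, \<tau> @ [B])"
      have y: "?y \<in> crit ?x B" using crit_succ N B by blast
      then have "?y \<in> W" "(?x, ?y) \<in> R" using crit_R R_W by blast+
      moreover from this have "sat FR val ?y A" using IH(1) N by simp
      ultimately obtain V where V: "(?y, V) \<in> SR ?x" "\<forall>z\<in>V. sat FR val z B"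
        using sat unfolding sat_Rhd_FR by blast
      \<comment> \<open>Since \<open>?y\<close> is \<open>B\<close>-critical, the second witness in
        \<open>V\<close> lacks \<open>B\<close>, so \<open>V\<close> cannot force
        \<open>B\<close>.\<close>
      then have "V \<subseteq> W" "\<exists>z\<in>V. B \<notin> fst z" using y by (auto simp: SR_def)
      then obtain z where z: "z \<in> V" "z \<in> W" "B \<notin> fst z" by blast
      then obtain N' \<sigma> where "z = (N' \<inter> \<Phi>, \<sigma>)" "mcs L N'" by (auto simp: W_def)
      then show False using IH(2) z V(2) B PhiI boxedI by auto
    qed
  next
    assume AB: "A \<^bold>\<rhd> B \<in> M"
    have "\<exists>V. (y, V) \<in> SR ?x \<and> (\<forall>z\<in>V. sat FR val z B)"
      if xy: "(?x, y) \<in> R" and yA: "sat FR val y A" for y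
    proof -
      have "y \<in> W" using R_W xy by blast
      then obtain Y \<sigma> where y: "y = (Y \<inter> \<Phi>, \<sigma>)" "mcs L Y" by (auto simp: W_def)
      then have "A \<in> Y" using yA IH(1) \<open>y \<in> W\<close> by blast
      have pr: "prec M Y" using xy y by (simp add: R_def)
      \<comment> \<open>By \<open>J2\<close>, B \<rhd> C in \<open>M\<close> would compose with A
        \<rhd> B to A \<rhd> C.\<close>
      have notB: "(\<^bold>\<not> \<^bold>\<not> B) \<^bold>\<rhd> C \<notin> M" if "A \<^bold>\<rhd> C \<notin> M" for C
        using that mcs_Rhd_trans[OF M AB] mcs_Rhd_left[OF M, of B "\<^bold>\<not> \<^bold>\<not> B" C] taut by auto
      have holds: "sat FR val (N \<inter> \<Phi>, \<rho>) B"
        if "mcs L N" "B \<in> N" "(N \<inter> \<Phi>, \<rho>) \<in> W" for N \<rho>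
        using that IH(2) by blast
      show ?thesis
      proof (cases "\<exists>C. y \<in> crit ?x C")
        case True
        then obtain C where yC: "y \<in> crit ?x C" by blast
        have C: "C \<in> S" using label_in_S[OF yC] .
        \<comment> \<open>Thus the clauses of \<open>SR\<close> have to be met for this single
          \<open>C\<close>.\<close>
        have uniq: "D = C" if "y \<in> crit ?x D" for D
          using that yC by (auto simp: crit_def)
        have "critical C M Y" using yC y C by (simp add: crit_def)
        then have AC: "A \<^bold>\<rhd> C \<notin> M" using \<open>A \<in> Y\<close> A by (auto simp: critical_def)
        obtain N where N: "mcs L N" "critical C M N" "\<^bold>\<not> B \<notin> N"
          using critical_boxed_successor[OF M _ notB[OF AC]] boxedI B by metis
        \<comment> \<open>First witness: a \<open>C\<close>-critical world satisfying
          \<open>B\<close>. The second, \<open>z\<close>, will satisfy \<open>B\<close> but not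
          \<open>C\<close>.\<close>
        let ?w = "(N \<inter> \<Phi>, \<tau> @ [C])"
        have w: "?w \<in> crit ?x C" using crit_succ N C by blast
        obtain z where z: "z \<in> W" "C \<notin> fst z" "sat FR val z B" "J4plus \<subseteq> L \<Longrightarrow> (?x, z) \<in> R"
        proof (cases "J4plus \<subseteq> L")
          case True
          have "\<^bold>\<box> (B \<^bold>\<longrightarrow> C) \<notin> M"
          proof
            assume "\<^bold>\<box> (B \<^bold>\<longrightarrow> C) \<in> M"
            moreover have "\<^bold>\<box> (B \<^bold>\<longrightarrow> C) \<^bold>\<longrightarrow> ((A \<^bold>\<rhd> B) \<^bold>\<longrightarrow> (A \<^bold>\<rhd> C)) \<in> M"
              using True by (intro mcs_thm[OF M] provable.Axiom) (auto simp: J4plus_def)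
            ultimately show False using M AB AC by simp
          qed
          then obtain N' where N': "mcs L N'" "prec M N'" "B \<^bold>\<longrightarrow> C \<notin> N'"
            using prec_successor[OF M] boxedI B C by metis
          then have R: "(?x, (N' \<inter> \<Phi>, \<tau> @ [C])) \<in> R" using succ C by blast
          show ?thesis
            by (rule that[of "(N' \<inter> \<Phi>, \<tau> @ [C])"]) (use N' R R_W[OF R] holds in auto)
        next
          case False
          \<comment> \<open>Rule \<open>R1\<close> gives only that B \<longrightarrow> C is
            unprovable, so \<open>z\<close> may lie anywhere in \<open>W\<close>; the empty label
            meets every length bound.\<close>
          have "\<not> L \<turnstile> B \<^bold>\<longrightarrow> C" using mcs_Rhd_right[OF M _ AB] AC by blast
          then obtain N' where N': "mcs L N'" "B \<^bold>\<longrightarrow> C \<notin> N'" using mcs_avoiding by blast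
          then have "(N' \<inter> \<Phi>, []) \<in> W" by (auto simp: W_def)
          with N' False show ?thesis using that holds by simp
        qed
        have "(?x, ?w) \<in> R" "?w \<in> W" "sat FR val ?w B"
          using crit_R[OF w] R_W holds N by auto
        with w z xy uniq show ?thesis
          by (intro exI[of _ "{?w, z}"]) (auto simp: SR_def)
      next
        case False
        \<comment> \<open>Over a noncritical \<open>y\<close> a single successor of \<open>x\<close>
          satisfying \<open>B\<close> is enough. It exists because \<open>y\<close> satisfies
          \<open>A\<close>: otherwise B \<rhd> \<bottom>, and with it A \<rhd> \<bottom>, would be
          in \<open>M\<close>.\<close>
        have "A \<^bold>\<rhd> \<^bold>\<bottom> \<notin> M"
        proof
          assume "A \<^bold>\<rhd> \<^bold>\<bottom> \<in> M"
          then have "(\<^bold>\<not> \<^bold>\<not> A) \<^bold>\<rhd> \<^bold>\<bottom> \<in> M"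
            by (rule mcs_Rhd_left[OF M, rotated]) (auto intro: taut)
          then have "\<^bold>\<box> \<^bold>\<not> A \<in> M" using mcs_Rhd_Bot[OF M] by blast
          then have "\<^bold>\<not> A \<in> Y" using pr A boxedI by (auto simp: prec_def)
          then show False using \<open>A \<in> Y\<close> y by simp
        qed
        then have "\<^bold>\<box> \<^bold>\<not> B \<notin> M" using notB mcs_Rhd_Bot[OF M] by blast
        then obtain N where N: "mcs L N" "prec M N" "\<^bold>\<not> B \<notin> N"
          using prec_successor[OF M] boxedI B by metis
        then have "(?x, (N \<inter> \<Phi>, \<tau> @ [B])) \<in> R" using succ B by blast
        with False xy N show ?thesis
          using R_W holds by (intro exI[of _ "{(N \<inter> \<Phi>, \<tau> @ [B])}"]) (auto simp: SR_def)
      qed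
    qed
    then show "sat FR val ?x (A \<^bold>\<rhd> B)" unfolding sat_Rhd_FR by blast
  qed
qed auto

lemma finite_countermodel:
  assumes "\<not> L \<turnstile> A0"
  shows "ILS_frame_of L FR" and "finite (Worlds FR)" and "\<not> valid FR A0"
proof -
  obtain M where M: "mcs L M" "A0 \<notin> M" using mcs_avoiding[OF assms] .
  then have W: "(M \<inter> \<Phi>, []) \<in> W" by (auto simp: W_def)
  then show "ILS_frame_of L FR" using ILS_frame_of_FR by blast
  show "finite (Worlds FR)" by (simp add: finite_W)
  have "\<not> sat FR val (M \<inter> \<Phi>, []) A0" using truth[OF W M(1)] M(2) by simp
  then show "\<not> valid FR A0" using W by (auto simp: valid_def)
qed

end

theorem theorem7p2:
  fixes L :: "fm set" and A :: fm
  assumes "infinite (UNIV :: 'w set)"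
    and "L = ILminus [J2, J5] \<or> L = ILminus [J2, J4plus, J5]"
  shows "(L \<turnstile> A \<longleftrightarrow> (\<forall>F :: 'w frame. ILS_frame_of L F \<longrightarrow> valid F A)) \<and>
         (L \<turnstile> A \<longleftrightarrow> (\<forall>F :: 'w frame. ILS_frame_of L F \<and> finite (Worlds F) \<longrightarrow> valid F A))"
proof -
  interpret canonical L A
    using assms(2) by unfold_locales (auto simp: ILminus_def)
  \<comment> \<open>One finite countermodel refutes validity in all frames and in all finite frames
    of the logic.\<close>
  have "\<exists>F :: 'w frame. ILS_frame_of L F \<and> finite (Worlds F) \<and> \<not> valid F A" if "\<not> L \<turnstile> A"
  proof -
    note FR = finite_countermodel[OF that]
    \<comment> \<open>An infinite type contains sets of every finite size, hence room for a copy of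
      the canonical frame.\<close>
    obtain X :: "'w set" where X: "finite X" "card X = card (Worlds FR)"
      using infinite_arbitrarily_large[OF assms(1)] by blast
    then obtain g where g: "bij_betw g X (Worlds FR)"
      using FR(2) finite_same_card_bij by blast
    have F: "ILS_frame FR" using FR(1) by (simp add: ILS_frame_of_def)
    have "ILS_frame_of L (pullback X g FR)"
      using FR(1) ILS_frame_pullback[OF F g] valid_pullback[OF F g]
      by (simp add: ILS_frame_of_def)
    moreover have "finite (Worlds (pullback X g FR))" using X by (simp add: pullback_def)
    moreover have "\<not> valid (pullback X g FR) A" using FR(3) valid_pullback[OF F g] by simp
    ultimately show ?thesis by blast
  qed
  then show ?thesis using soundness by metis
qed

end
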